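(* Let $A,B,C$ be a Leonard triple on $V$ that has $q$-Racah type with Huang data $(a,b,c,d)$, and let $\overline A,\overline B,\overline C\in\mathrm{End}(V)$ be as defined in the context. For $X\in\mathrm{End}(V)$ let $\langle X\rangle$ denote the $\mathbb F$-subalgebra of $\mathrm{End}(V)$ generated by $X$. Then $\overline A\in\langle A\rangle$, $\overline B\in\langle B\rangle$ and $\overline C\in\langle C\rangle$.
   Context: Let $\mathbb F$ be a field, $d\ge 0$ an integer, $V$ a vector space over $\mathbb F$ of dimension $d+1$, $\mathrm{End}(V)$ the $\mathbb F$-algebra of $\mathbb F$-linear maps $V\to V$, and $I$ its identity. Subalgebras contain $I$. A square matrix is tridiagonal if each nonzero entry lies on the diagonal, subdiagonal or superdiagonal; a tridiagonal matrix is irreducible if every subdiagonal entry and every superdiagonal entry is nonzero. Leonard triple on $V$: a 3-tuple $A,B,C$ of elements of $\mathrm{End}(V)$ such that (i) there is a basis of $V$ with respect to which $A$ is represented by a diagonal matrix and $B,C$ by irreducible tridiagonal matrices; (ii) there is a basis with respect to which $B$ is diagonal and $C,A$ are irreducible tridiagonal; (iii) there is a basis with respect to which $C$ is diagonal and $A,B$ are irreducible tridiagonal. Each of $A,B,C$ is then diagonalizable with one-dimensional eigenspaces. An ordering of the eigenvalues of $A$ is standard if corresponding eigenvectors, in that order, form a basis as in (i); similarly for $B$ with (ii) and $C$ with (iii). Standing assumptions: fix a nonzero $q\in\mathbb F$ with $q^4\ne 1$ and nonzero $a,b,c\in\mathbb F$ such that $q^{2i}\ne 1$ for $1\le i\le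 d$; none of $a^2,b^2,c^2$ is among $q^{2d-2},q^{2d-4},\ldots,q^{2-2d}$; none of $abc,a^{-1}bc,ab^{-1}c,abc^{-1}$ is among $q^{d-1},q^{d-3},\ldots,q^{1-d}$. For $0\le i\le d$ let $\theta_i=aq^{2i-d}+a^{-1}q^{d-2i}$, $\theta'_i=bq^{2i-d}+b^{-1}q^{d-2i}$, $\theta''_i=cq^{2i-d}+c^{-1}q^{d-2i}$. A Leonard triple $A,B,C$ on $V$ has $q$-Racah type with Huang data $(a,b,c,d)$ if $\{\theta_i\}_{i=0}^d$, $\{\theta'_i\}_{i=0}^d$, $\{\theta''_i\}_{i=0}^d$ are standard orderings of the eigenvalues of $A$, $B$, $C$ respectively, and $$A+\frac{qBC-q^{-1}CB}{q^2-q^{-2}}=\alpha_a I,\quad B+\frac{qCA-q^{-1}AC}{q^2-q^{-2}}=\alpha_b I,\quad C+\frac{qAB-q^{-1}BA}{q^2-q^{-2}}=\alpha_c I,$$ where $\alpha_a=\frac{(a+a^{-1})(q^{d+1}+q^{-d-1})+(b+b^{-1})(c+c^{-1})}{q+q^{-1}}$, $\alpha_b=\frac{(b+b^{-1})(q^{d+1}+q^{-d-1})+(c+c^{-1})(a+a^{-1})}{q+q^{-1}}$, $\alpha_c=\frac{(c+c^{-1})(q^{d+1}+q^{-d-1})+(a+a^{-1})(b+b^{-1})}{q+q^{-1}}$. For $0\le i\le d$ let $E_i$ (resp. $E'_i$, $E''_i$) be the primitive idempotent of $A$ (resp. $B$, $C$) for $\theta_i$ (resp. $\theta'_i$, $\theta''_i$):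 the projection of $V$ onto that eigenspace that is zero on the other eigenspaces. Define $$W=\sum_{i=0}^d(-1)^ia^{-i}q^{i(d-i)}E_i,\quad W'=\sum_{i=0}^d(-1)^ib^{-i}q^{i(d-i)}E'_i,\quad W''=\sum_{i=0}^d(-1)^ic^{-i}q^{i(d-i)}E''_i,$$ which are invertible, and $$\overline A=W^{-1}BW-C,\quad \overline B=(W')^{-1}CW'-A,\quad \overline C=(W'')^{-1}AW''-B.$$ *)

theory Defs
  imports Complex_Main
begin

text \<open>
  A vector space over a field is given by its scalar multiplication
  \<open>scale :: 'f \<Rightarrow> 'v \<Rightarrow> 'v\<close>, as in the locale \<open>vector_space\<close>; the vector space is the whole
  type \<open>'v\<close>. Its endomorphisms are functions \<open>'v \<Rightarrow> 'v\<close>. Vectors of a basis and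
  rows and columns of a matrix are indexed by \<open>0, \<dots>, d\<close>; values at larger indices are irrelevant.
\<close>

definition End_alg :: "('f::field \<Rightarrow> 'v::ab_group_add \<Rightarrow> 'v) \<Rightarrow> ('v \<Rightarrow> 'v) set" where
  "End_alg scale = {X. Vector_Spaces.linear scale scale X}"

definition is_subalgebra ::
  "('f::field \<Rightarrow> 'v::ab_group_add \<Rightarrow> 'v) \<Rightarrow> ('v \<Rightarrow> 'v) set \<Rightarrow> bool" where
  "is_subalgebra scale S \<longleftrightarrow>
     S \<subseteq> End_alg scale \<and> id \<in> S \<and>
     (\<forall>X\<in>S. \<forall>Y\<in>S. (\<lambda>v. X v + Y v) \<in> S \<and> X \<circ> Y \<in> S) \<and>
     (\<forall>k. \<forall>X\<in>S. (\<lambda>v. scale k (X v)) \<in> S)"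

definition generated_subalgebra ::
  "('f::field \<Rightarrow> 'v::ab_group_add \<Rightarrow> 'v) \<Rightarrow> ('v \<Rightarrow> 'v) \<Rightarrow> ('v \<Rightarrow> 'v) set" where
  "generated_subalgebra scale X = is_subalgebra scale hull {X}"

definition is_basis ::
  "('f::field \<Rightarrow> 'v::ab_group_add \<Rightarrow> 'v) \<Rightarrow> nat \<Rightarrow> (nat \<Rightarrow> 'v) \<Rightarrow> bool" where
  "is_basis scale d v \<longleftrightarrow>
     inj_on v {..d} \<and> \<not> module.dependent scale (v ` {..d}) \<and>
     module.span scale (v ` {..d}) = UNIV"

text \<open>Column convention: \<open>X (v j)\<close> is the sum over \<open>i\<close> of \<open>matrix_wrt scale d v X i j\<close> times \<open>v i\<close>.\<close>

definition matrix_wrt ::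
  "('f::field \<Rightarrow> 'v::ab_group_add \<Rightarrow> 'v) \<Rightarrow> nat \<Rightarrow> (nat \<Rightarrow> 'v) \<Rightarrow> ('v \<Rightarrow> 'v) \<Rightarrow> nat \<Rightarrow> nat \<Rightarrow> 'f" where
  "matrix_wrt scale d v X i j = module.representation scale (v ` {..d}) (X (v j)) (v i)"

definition diagonal :: "nat \<Rightarrow> (nat \<Rightarrow> nat \<Rightarrow> 'f::zero) \<Rightarrow> bool" where
  "diagonal d M \<longleftrightarrow> (\<forall>i\<le>d. \<forall>j\<le>d. M i j \<noteq> 0 \<longrightarrow> i = j)"

definition tridiagonal :: "nat \<Rightarrow> (nat \<Rightarrow> nat \<Rightarrow> 'f::zero) \<Rightarrow> bool" where
  "tridiagonal d M \<longleftrightarrow>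
     (\<forall>i\<le>d. \<forall>j\<le>d. M i j \<noteq> 0 \<longrightarrow> i = j \<or> i = Suc j \<or> j = Suc i)"

definition irreducible_tridiagonal :: "nat \<Rightarrow> (nat \<Rightarrow> nat \<Rightarrow> 'f::zero) \<Rightarrow> bool" where
  "irreducible_tridiagonal d M \<longleftrightarrow>
     tridiagonal d M \<and> (\<forall>i<d. M (Suc i) i \<noteq> 0 \<and> M i (Suc i) \<noteq> 0)"

definition leonard_basis ::
  "('f::field \<Rightarrow> 'v::ab_group_add \<Rightarrow> 'v) \<Rightarrow> nat \<Rightarrow> ('v \<Rightarrow> 'v) \<Rightarrow> ('v \<Rightarrow> 'v) \<Rightarrow> ('v \<Rightarrow> 'v)
     \<Rightarrow> (nat \<Rightarrow> 'v) \<Rightarrow> bool" where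
  "leonard_basis scale d A B C v \<longleftrightarrow>
     is_basis scale d v \<and>
     diagonal d (matrix_wrt scale d v A) \<and>
     irreducible_tridiagonal d (matrix_wrt scale d v B) \<and>
     irreducible_tridiagonal d (matrix_wrt scale d v C)"

definition leonard_triple ::
  "('f::field \<Rightarrow> 'v::ab_group_add \<Rightarrow> 'v) \<Rightarrow> nat \<Rightarrow> ('v \<Rightarrow> 'v) \<Rightarrow> ('v \<Rightarrow> 'v) \<Rightarrow> ('v \<Rightarrow> 'v) \<Rightarrow> bool" where
  "leonard_triple scale d A B C \<longleftrightarrow>
     A \<in> End_alg scale \<and> B \<in> End_alg scale \<and> C \<in> End_alg scale \<and>
     (\<exists>v. leonard_basis scale d A B C v) \<and>
     (\<exists>v. leonard_basis scale d B C A v) \<and>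
     (\<exists>v. leonard_basis scale d C A B v)"

definition eigenspace ::
  "('f::field \<Rightarrow> 'v::ab_group_add \<Rightarrow> 'v) \<Rightarrow> ('v \<Rightarrow> 'v) \<Rightarrow> 'f \<Rightarrow> 'v set" where
  "eigenspace scale X t = {v. X v = scale t v}"

definition eigenvalues ::
  "('f::field \<Rightarrow> 'v::ab_group_add \<Rightarrow> 'v) \<Rightarrow> ('v \<Rightarrow> 'v) \<Rightarrow> 'f set" where
  "eigenvalues scale X = {t. \<exists>v. v \<noteq> 0 \<and> v \<in> eigenspace scale X t}"

text \<open>
  \<open>th 0, \<dots>, th d\<close> is a standard ordering of the eigenvalues of the first of the three maps.
  The existential choice of eigenvectors is harmless: for a Leonard triple the eigenspaces
  are one-dimensional, and rescaling the basis vectors preserves \<open>leonard_basis\<close>.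
\<close>

definition standard_ordering ::
  "('f::field \<Rightarrow> 'v::ab_group_add \<Rightarrow> 'v) \<Rightarrow> nat \<Rightarrow> ('v \<Rightarrow> 'v) \<Rightarrow> ('v \<Rightarrow> 'v) \<Rightarrow> ('v \<Rightarrow> 'v)
     \<Rightarrow> (nat \<Rightarrow> 'f) \<Rightarrow> bool" where
  "standard_ordering scale d A B C th \<longleftrightarrow>
     bij_betw th {..d} (eigenvalues scale A) \<and>
     (\<exists>v. leonard_basis scale d A B C v \<and> (\<forall>i\<le>d. v i \<in> eigenspace scale A (th i)))"

definition huang_eigenvalue :: "'f::field \<Rightarrow> nat \<Rightarrow> 'f \<Rightarrow> nat \<Rightarrow> 'f" where
  "huang_eigenvalue q d x i =
     x * q powi (2 * int i - int d) + inverse x * q powi (int d - 2 * int i)"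

definition huang_alpha :: "'f::field \<Rightarrow> nat \<Rightarrow> 'f \<Rightarrow> 'f \<Rightarrow> 'f \<Rightarrow> 'f" where
  "huang_alpha q d x y z =
     ((x + inverse x) * (q powi (int d + 1) + q powi (- int d - 1))
       + (y + inverse y) * (z + inverse z)) / (q + inverse q)"

definition huang_relation ::
  "('f::field \<Rightarrow> 'v::ab_group_add \<Rightarrow> 'v) \<Rightarrow> 'f \<Rightarrow> ('v \<Rightarrow> 'v) \<Rightarrow> ('v \<Rightarrow> 'v) \<Rightarrow> ('v \<Rightarrow> 'v) \<Rightarrow> 'f \<Rightarrow> bool" where
  "huang_relation scale q X Y Z r \<longleftrightarrow>
     (\<forall>v. X v + scale (inverse (q powi 2 - q powi (- 2)))
                  (scale q (Y (Z v)) - scale (inverse q) (Z (Y v)))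
          = scale r v)"

definition q_racah_triple ::
  "('f::field \<Rightarrow> 'v::ab_group_add \<Rightarrow> 'v) \<Rightarrow> 'f \<Rightarrow> 'f \<Rightarrow> 'f \<Rightarrow> 'f \<Rightarrow> nat
     \<Rightarrow> ('v \<Rightarrow> 'v) \<Rightarrow> ('v \<Rightarrow> 'v) \<Rightarrow> ('v \<Rightarrow> 'v) \<Rightarrow> bool" where
  "q_racah_triple scale q a b c d A B C \<longleftrightarrow>
     leonard_triple scale d A B C \<and>
     standard_ordering scale d A B C (huang_eigenvalue q d a) \<and>
     standard_ordering scale d B C A (huang_eigenvalue q d b) \<and>
     standard_ordering scale d C A B (huang_eigenvalue q d c) \<and>
     huang_relation scale q A B C (huang_alpha q d a b c) \<and>
     huang_relation scale q B C A (huang_alpha q d b c a) \<and>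
     huang_relation scale q C A B (huang_alpha q d c a b)"

text \<open>
  The description below determines the map uniquely when \<open>X\<close> is diagonalizable and \<open>t\<close> is
  one of its eigenvalues; it is not meant to be used otherwise.
\<close>

definition primitive_idempotent ::
  "('f::field \<Rightarrow> 'v::ab_group_add \<Rightarrow> 'v) \<Rightarrow> ('v \<Rightarrow> 'v) \<Rightarrow> 'f \<Rightarrow> ('v \<Rightarrow> 'v)" where
  "primitive_idempotent scale X t =
     (THE E. E \<in> End_alg scale \<and> range E = eigenspace scale X t \<and>
        (\<forall>v\<in>eigenspace scale X t. E v = v) \<and>
        (\<forall>s. s \<noteq> t \<longrightarrow> (\<forall>v\<in>eigenspace scale X s. E v = 0)))"

definition W_map ::
  "('f::field \<Rightarrow> 'v::ab_group_add \<Rightarrow> 'v) \<Rightarrow> 'f \<Rightarrow> nat \<Rightarrow> 'f \<Rightarrow> ('v \<Rightarrow> 'v) \<Rightarrow> ('v \<Rightarrow> 'v)" where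
  "W_map scale q d x X = (\<lambda>v. \<Sum>i\<le>d.
     scale ((- 1) ^ i * x powi (- int i) * q ^ (i * (d - i)))
       (primitive_idempotent scale X (huang_eigenvalue q d x i) v))"

text \<open>
  With \<open>W = W_map scale q d x X\<close>, this is the map obtained by conjugating \<open>Y\<close> to
  \<open>W\<inverse> Y W\<close> and subtracting \<open>Z\<close>.
\<close>

definition bar_map ::
  "('f::field \<Rightarrow> 'v::ab_group_add \<Rightarrow> 'v) \<Rightarrow> 'f \<Rightarrow> nat \<Rightarrow> 'f \<Rightarrow> ('v \<Rightarrow> 'v) \<Rightarrow> ('v \<Rightarrow> 'v) \<Rightarrow> ('v \<Rightarrow> 'v)
     \<Rightarrow> ('v \<Rightarrow> 'v)" where
  "bar_map scale q d x X Y Z =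
     (\<lambda>v. inv (W_map scale q d x X) (Y (W_map scale q d x X v)) - Z v)"

end

theory Submission
  imports Defs
begin

text \<open>
  In an eigenbasis of \<open>A\<close> the map \<open>W\<close> is diagonal, so conjugation by \<open>W\<close> multiplies the \<open>(i, j)\<close>
  entry of \<open>B\<close> by \<open>t\<^sub>j / t\<^sub>i\<close>, where \<open>t\<^sub>i = (-1)\<^sup>i a\<^sup>-\<^sup>i q\<^bsup>i(d-i)\<^esup>\<close>. On the other hand, the relation
  that expresses \<open>C\<close> through \<open>qAB - q\<^sup>-\<^sup>1BA\<close> multiplies each off-diagonal entry of \<open>B\<close> by
  \<open>- (q \<theta>\<^sub>i - q\<^sup>-\<^sup>1 \<theta>\<^sub>j) / (q\<^sup>2 - q\<^sup>-\<^sup>2)\<close> to give that of \<open>C\<close>. As \<open>B\<close> is tridiagonal, only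
  \<open>j = i \<plusminus> 1\<close> matters, and there the two factors agree
  (\<open>huang_eigenvalue_steps\<close>, \<open>W_weight_Suc\<close>). Hence \<open>W\<^sup>-\<^sup>1BW - C\<close> is diagonal in the eigenbasis of
  \<open>A\<close>. The eigenvalues of \<open>A\<close> are distinct, so by Lagrange interpolation every such diagonal map
  is a polynomial in \<open>A\<close> (\<open>diag_op_in_generated\<close>). The hypotheses are invariant under cyclic
  shifts of \<open>(A, B, C)\<close> and \<open>(a, b, c)\<close>, and this yields the other two claims.
\<close>

section \<open>Diagonal maps in a simple eigenbasis\<close>

text \<open>
  A linear map with a basis of eigenvectors whose eigenvalues are pairwise distinct, so that its
  primitive idempotents are the coordinate projections.
\<close>

locale simple_eigenbasis = vector_space scale
  for scale :: "'f::field \<Rightarrow> 'v::ab_group_add \<Rightarrow> 'v" +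
  fixes d :: nat and v :: "nat \<Rightarrow> 'v" and X :: "'v \<Rightarrow> 'v" and th :: "nat \<Rightarrow> 'f"
  assumes basis: "is_basis scale d v"
    and linear_X: "Vector_Spaces.linear scale scale X"
    and eigen: "i \<le> d \<Longrightarrow> X (v i) = scale (th i) (v i)"
    and distinct: "inj_on th {..d}"
begin

definition coord :: "nat \<Rightarrow> 'v \<Rightarrow> 'f" where
  "coord i x = representation (v ` {..d}) x (v i)"

definition diag_op :: "(nat \<Rightarrow> 'f) \<Rightarrow> 'v \<Rightarrow> 'v" where
  "diag_op m x = (\<Sum>i\<le>d. scale (m i * coord i x) (v i))"

lemma inj_basis: "inj_on v {..d}"
  and independent_basis: "independent (v ` {..d})"
  and span_basis: "span (v ` {..d}) = UNIV"
  using basis by (auto simp: is_basis_def)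

lemma coord_add: "coord i (x + y) = coord i x + coord i y"
  by (simp add: coord_def representation_add independent_basis span_basis)

lemma coord_diff: "coord i (x - y) = coord i x - coord i y"
  by (simp add: coord_def representation_diff independent_basis span_basis)

lemma coord_scale: "coord i (scale k x) = k * coord i x"
  by (simp add: coord_def representation_scale independent_basis span_basis)

lemma coord_zero: "coord i 0 = 0"
  by (simp add: coord_def representation_zero)

lemma coord_sum: "coord i (\<Sum>j\<in>J. f j) = (\<Sum>j\<in>J. coord i (f j))"
  by (induction J rule: infinite_finite_induct) (simp_all add: coord_add coord_zero)

lemma coord_basis:
  assumes "i \<le> d" "j \<le> d"
  shows "coord i (v j) = (if i = j then 1 else 0)"
  using assms inj_basis
  by (auto simp: coord_def representation_basis independent_basis inj_on_eq_iff)

lemma coord_expansion: "(\<Sum>i\<le>d. scale (coord i x) (v i)) = x"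
  using sum_representation_eq[OF independent_basis, of x "v ` {..d}"]
  by (simp add: span_basis coord_def sum.reindex[OF inj_basis])

lemma coord_eqI:
  assumes "\<And>i. i \<le> d \<Longrightarrow> coord i x = coord i y"
  shows "x = y"
proof -
  have "(\<Sum>i\<le>d. scale (coord i x) (v i)) = (\<Sum>i\<le>d. scale (coord i y) (v i))"
    by (rule sum.cong) (simp_all add: assms)
  then show ?thesis by (simp only: coord_expansion)
qed

lemma coord_combination:
  assumes "i \<le> d"
  shows "coord i (\<Sum>j\<le>d. scale (f j) (v j)) = f i"
proof -
  have "coord i (\<Sum>j\<le>d. scale (f j) (v j)) = (\<Sum>j\<le>d. if i = j then f j else 0)"
    unfolding coord_sum by (rule sum.cong) (use assms in \<open>auto simp: coord_scale coord_basis\<close>)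
  then show ?thesis using assms by simp
qed

lemma coord_diag_op: "i \<le> d \<Longrightarrow> coord i (diag_op m x) = m i * coord i x"
  by (simp add: diag_op_def coord_combination)

lemma linear_expansion:
  assumes "Vector_Spaces.linear scale scale f"
  shows "f x = (\<Sum>j\<le>d. scale (coord j x) (f (v j)))"
proof -
  interpret f: Vector_Spaces.linear scale scale f by (fact assms)
  show ?thesis
    by (subst coord_expansion[of x, symmetric]) (simp only: f.sum f.scale)
qed

lemma coord_linear:
  assumes "Vector_Spaces.linear scale scale f"
  shows "coord i (f x) = (\<Sum>j\<le>d. coord j x * coord i (f (v j)))"
  by (subst linear_expansion[OF assms]) (simp add: coord_sum coord_scale)

lemma X_eq_diag_op: "X = diag_op th"
proof
  fix x
  show "X x = diag_op th x"
    by (subst linear_expansion[OF linear_X])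
      (simp add: diag_op_def eigen mult.commute)
qed

lemma eigenspace_iff:
  "x \<in> eigenspace scale X s \<longleftrightarrow> (\<forall>i\<le>d. th i = s \<or> coord i x = 0)"
proof -
  have "x \<in> eigenspace scale X s \<longleftrightarrow> (\<forall>i\<le>d. coord i (X x) = coord i (scale s x))"
    unfolding eigenspace_def using coord_eqI[of "X x" "scale s x"] by auto
  also have "\<dots> \<longleftrightarrow> (\<forall>i\<le>d. th i * coord i x = s * coord i x)"
    by (simp add: X_eq_diag_op coord_diag_op coord_scale)
  finally show ?thesis by auto
qed

lemma primitive_idempotent_eq:
  assumes "i \<le> d"
  shows "primitive_idempotent scale X (th i) = (\<lambda>x. scale (coord i x) (v i))"
    (is "_ = ?P")
proof -
  have th_eq: "th j = th i \<longleftrightarrow> j = i" if "j \<le> d" for j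
    using distinct that assms by (auto simp: inj_on_eq_iff)
  have fixed: "?P x = x" if "x \<in> eigenspace scale X (th i)" for x
    using that assms
    by (intro coord_eqI) (auto simp: eigenspace_iff th_eq coord_scale coord_basis)
  have into: "?P x \<in> eigenspace scale X (th i)" for x
    using assms by (auto simp: eigenspace_iff coord_scale coord_basis)
  have kill: "?P x = 0" if "s \<noteq> th i" "x \<in> eigenspace scale X s" for x s
    using that assms by (auto simp: eigenspace_iff)
  have lin: "?P \<in> End_alg scale"
    using vector_space_axioms
    by (simp add: End_alg_def Vector_Spaces.linear_iff coord_add coord_scale scale_left_distrib)
  show ?thesis
    unfolding primitive_idempotent_def
  proof (rule the_equality, intro conjI)
    show "range ?P = eigenspace scale X (th i)"
      using fixed into by (auto, metis rangeI)
  next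
    fix E
    assume E: "E \<in> End_alg scale \<and> range E = eigenspace scale X (th i) \<and>
        (\<forall>x\<in>eigenspace scale X (th i). E x = x) \<and>
        (\<forall>s. s \<noteq> th i \<longrightarrow> (\<forall>x\<in>eigenspace scale X s. E x = 0))"
    have on_basis: "E (v j) = ?P (v j)" if "j \<le> d" for j
    proof -
      have vj: "v j \<in> eigenspace scale X (th j)" using eigen that by (simp add: eigenspace_def)
      show ?thesis
      proof (cases "j = i")
        case True
        then have "E (v j) = v j" using E vj by blast
        then show ?thesis using True assms by (simp add: coord_basis)
      next
        case False
        then have "E (v j) = 0" using E vj th_eq[OF that] by blast
        then show ?thesis using False assms that by (simp add: coord_basis)
      qed
    qed
    have "E x = ?P x" for x
    proof -
      have "E x = (\<Sum>j\<le>d. scale (coord j x) (E (v j)))"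
        using E by (intro linear_expansion) (simp add: End_alg_def)
      also have "\<dots> = (\<Sum>j\<le>d. scale (coord j x) (?P (v j)))"
        by (rule sum.cong) (simp_all add: on_basis)
      also have "\<dots> = ?P x"
        using lin by (intro linear_expansion[symmetric]) (simp add: End_alg_def)
      finally show ?thesis .
    qed
    then show "E = ?P" by (rule ext)
  next
    show "\<forall>x\<in>eigenspace scale X (th i). ?P x = x" using fixed by blast
  next
    show "\<forall>s. s \<noteq> th i \<longrightarrow> (\<forall>x\<in>eigenspace scale X s. ?P x = 0)" using kill by blast
  qed (fact lin)
qed

text \<open>
  The diagonal maps in a subalgebra form a ring of functions on the indices. It contains the
  injective function \<open>th\<close>, hence all the Lagrange polynomials in it.
\<close>

lemma diag_op_in_subalgebra:
  assumes S: "is_subalgebra scale S" and "X \<in> S"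
  shows "diag_op m \<in> S"
proof -
  have S_id: "id \<in> S" using S by (simp add: is_subalgebra_def)
  have S_add: "(\<lambda>x. F x + G x) \<in> S" and S_comp: "F \<circ> G \<in> S"
    and S_scale: "(\<lambda>x. scale r (F x)) \<in> S" if "F \<in> S" "G \<in> S" for F G r
    using S that unfolding is_subalgebra_def by blast+
  have one: "diag_op (\<lambda>_. 1) \<in> S"
  proof -
    have "diag_op (\<lambda>_. 1) = id" by (intro ext coord_eqI) (simp add: coord_diag_op)
    then show ?thesis using S_id by simp
  qed
  have add: "diag_op (\<lambda>k. f k + g k) \<in> S" if "diag_op f \<in> S" "diag_op g \<in> S" for f g
  proof -
    have "diag_op (\<lambda>k. f k + g k) = (\<lambda>x. diag_op f x + diag_op g x)"
      by (intro ext coord_eqI) (simp add: coord_diag_op coord_add distrib_right)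
    then show ?thesis using S_add[OF that] by simp
  qed
  have mult: "diag_op (\<lambda>k. f k * g k) \<in> S" if "diag_op f \<in> S" "diag_op g \<in> S" for f g
  proof -
    have "diag_op (\<lambda>k. f k * g k) = diag_op f \<circ> diag_op g"
      by (intro ext coord_eqI) (simp add: coord_diag_op)
    then show ?thesis using S_comp[OF that] by simp
  qed
  have smult: "diag_op (\<lambda>k. r * f k) \<in> S" if "diag_op f \<in> S" for f r
  proof -
    have "diag_op (\<lambda>k. r * f k) = (\<lambda>x. scale r (diag_op f x))"
      by (intro ext coord_eqI) (simp add: coord_diag_op coord_scale)
    then show ?thesis using S_scale[OF that that] by simp
  qed
  have th: "diag_op th \<in> S" using \<open>X \<in> S\<close> by (simp flip: X_eq_diag_op)
  have sums: "diag_op (\<lambda>k. \<Sum>i\<in>J. g i k) \<in> S"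
    if "finite J" "\<And>i. i \<in> J \<Longrightarrow> diag_op (g i) \<in> S" for J and g :: "nat \<Rightarrow> nat \<Rightarrow> 'f"
    using that
  proof (induction J)
    case empty
    show ?case using smult[OF one, of 0] by simp
  next
    case (insert j J)
    then have "diag_op (\<lambda>k. g j k + (\<Sum>i\<in>J. g i k)) \<in> S" by (intro add) auto
    then show ?case using insert.hyps by simp
  qed
  have prods: "diag_op (\<lambda>k. \<Prod>j\<in>J. th k - th j) \<in> S" if "finite J" for J
    using that
  proof (induction J)
    case empty
    show ?case using one by simp
  next
    case (insert j J)
    have "diag_op (\<lambda>k. th k + - th j * 1) \<in> S"
      by (intro add smult th one)
    from mult[OF this insert.IH] show ?case using insert.hyps by simp
  qed
  \<comment> \<open>\<open>N i\<close> is the numerator of the Lagrange polynomial of the node \<open>th i\<close>.\<close>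
  define N where "N i k = (\<Prod>j\<in>{..d} - {i}. th k - th j)" for i k
  have N_self: "N i i \<noteq> 0" if "i \<le> d" for i
    using distinct that by (auto simp: N_def inj_on_eq_iff)
  have N_other: "N i k = 0" if "k \<le> d" "k \<noteq> i" for i k
    using that by (auto simp: N_def)
  have "(\<Sum>i\<le>d. m i / N i i * N i k) = m k" if "k \<le> d" for k
  proof -
    have "(\<Sum>i\<le>d. m i / N i i * N i k) = (\<Sum>i\<le>d. if i = k then m i else 0)"
      by (rule sum.cong) (use that N_self N_other in auto)
    then show ?thesis using that by simp
  qed
  then have "diag_op (\<lambda>k. \<Sum>i\<le>d. m i / N i i * N i k) = diag_op m"
    by (intro ext coord_eqI) (simp add: coord_diag_op)
  moreover have "diag_op (\<lambda>k. \<Sum>i\<le>d. m i / N i i * N i k) \<in> S"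
    by (intro sums smult) (simp_all add: N_def prods)
  ultimately show ?thesis by simp
qed

lemma diag_op_in_generated: "diag_op m \<in> generated_subalgebra scale X"
  unfolding generated_subalgebra_def hull_def using diag_op_in_subalgebra by auto

text \<open>
  For \<open>W = diag_op t\<close>, conjugation multiplies the \<open>(i, j)\<close> entry of \<open>Y\<close> by \<open>t j / t i\<close>, so the
  hypothesis \<open>tZ\<close> makes \<open>W\<^sup>-\<^sup>1YW\<close> and \<open>Z\<close> agree off the diagonal. With \<open>M\<close> the claimed difference,
  the proof compares coordinates in \<open>W(Z + M) = YW\<close>, which avoids an explicit formula for \<open>W\<^sup>-\<^sup>1\<close>.
\<close>

lemma conjugate_minus_eq_diag_op:
  assumes Y: "Vector_Spaces.linear scale scale Y" and Z: "Vector_Spaces.linear scale scale Z"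
    and t: "\<And>i. i \<le> d \<Longrightarrow> t i \<noteq> 0"
    and tZ: "\<And>i j. i \<le> d \<Longrightarrow> j \<le> d \<Longrightarrow> i \<noteq> j \<Longrightarrow>
               t i * coord i (Z (v j)) = t j * coord i (Y (v j))"
  shows "(\<lambda>x. inv (diag_op t) (Y (diag_op t x)) - Z x) =
         diag_op (\<lambda>i. coord i (Y (v i)) - coord i (Z (v i)))" (is "_ = diag_op ?m")
proof
  fix x
  have inj: "inj (diag_op t)"
  proof (rule injI)
    fix x y assume "diag_op t x = diag_op t y"
    then have "t i * coord i x = t i * coord i y" if "i \<le> d" for i
      using that by (metis coord_diag_op)
    then show "x = y" using t by (auto intro: coord_eqI)
  qed
  have "diag_op t (Z x + diag_op ?m x) = Y (diag_op t x)"
  proof (rule coord_eqI)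
    fix i assume i: "i \<le> d"
    have "coord i (diag_op t (Z x + diag_op ?m x)) =
        (\<Sum>j\<le>d. coord j x * (t i * coord i (Z (v j)))) + t i * ?m i * coord i x"
      using i coord_linear[OF Z, of i x]
      by (simp add: coord_diag_op coord_add distrib_left sum_distrib_left mult.assoc mult.left_commute)
    also have "t i * ?m i * coord i x = (\<Sum>j\<le>d. if j = i then t j * ?m j * coord j x else 0)"
      using i by simp
    also have "(\<Sum>j\<le>d. coord j x * (t i * coord i (Z (v j)))) + \<dots> =
        (\<Sum>j\<le>d. coord j x * (t j * coord i (Y (v j))))"
      unfolding sum.distrib[symmetric]
      by (rule sum.cong) (use i tZ in \<open>auto simp: algebra_simps\<close>)
    also have "\<dots> = coord i (Y (diag_op t x))"
      by (subst coord_linear[OF Y]) (simp add: coord_diag_op mult_ac)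
    finally show "coord i (diag_op t (Z x + diag_op ?m x)) = coord i (Y (diag_op t x))" .
  qed
  then have "inv (diag_op t) (Y (diag_op t x)) = Z x + diag_op ?m x"
    by (rule inv_f_eq[OF inj])
  then show "inv (diag_op t) (Y (diag_op t x)) - Z x = diag_op ?m x" by simp
qed

end

section \<open>Eigenvalues of A and weights of W\<close>

text \<open>
  An eigenvalue is a sum of two terms that scale by \<open>q\<^sup>2\<close> and \<open>q\<^sup>-\<^sup>2\<close> from one index to the next; in
  each combination below one of the two terms cancels. What remains, divided by
  \<open>-(q\<^sup>2 - q\<^sup>-\<^sup>2)\<close>, is a ratio of consecutive weights in \<open>W_weight_Suc\<close>.
\<close>

lemma huang_eigenvalue_steps:
  fixes q x :: "'f::field"
  assumes "q \<noteq> 0" "x \<noteq> 0"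
  defines "K \<equiv> q powi 2 - q powi (- 2)"
  shows "q * huang_eigenvalue q d x i - inverse q * huang_eigenvalue q d x (Suc i) =
           K * (inverse x * q powi (int d - 2 * int i - 1))"
    and "q * huang_eigenvalue q d x (Suc i) - inverse q * huang_eigenvalue q d x i =
           K * (x * q powi (2 * int i + 1 - int d))"
proof -
  define p where "p = q powi (2 * int i - int d)"
  have p: "p \<noteq> 0" using assms by (simp add: p_def)
  have flip: "q powi (- k) = inverse (q powi k)" for k by (rule power_int_minus)
  have e1: "q powi (int d - 2 * int i) = inverse p"
    using flip[of "2 * int i - int d"] by (simp add: p_def)
  have e2: "q powi (2 * int (Suc i) - int d) = p * q ^ 2"
    using power_int_add[of q "2 * int i - int d" 2] assms by (simp add: p_def algebra_simps)
  have e3: "q powi (int d - 2 * int (Suc i)) = inverse (p * q ^ 2)"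
    using flip[of "2 * int (Suc i) - int d"] e2 by simp
  have e4: "q powi (2 * int i + 1 - int d) = p * q"
    using power_int_add[of q "2 * int i - int d" 1] assms by (simp add: p_def algebra_simps)
  have e5: "q powi (int d - 2 * int i - 1) = inverse (p * q)"
    using flip[of "2 * int i + 1 - int d"] e4 by (simp add: algebra_simps)
  have e6: "K = q ^ 2 - inverse (q ^ 2)"
    by (simp add: K_def power_int_minus)
  show "q * huang_eigenvalue q d x i - inverse q * huang_eigenvalue q d x (Suc i) =
           K * (inverse x * q powi (int d - 2 * int i - 1))"
    and "q * huang_eigenvalue q d x (Suc i) - inverse q * huang_eigenvalue q d x i =
           K * (x * q powi (2 * int i + 1 - int d))"
    unfolding huang_eigenvalue_def p_def[symmetric] e1 e2 e3 e4 e5 e6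
    using assms(1,2) p by (simp_all add: field_simps power2_eq_square)
qed

text \<open>The eigenvalues of the map \<open>W\<close>.\<close>

definition W_weight :: "'f::field \<Rightarrow> nat \<Rightarrow> 'f \<Rightarrow> nat \<Rightarrow> 'f" where
  "W_weight q d x i = (- 1) ^ i * x powi (- int i) * q ^ (i * (d - i))"

lemma W_weight_Suc:
  assumes "q \<noteq> 0" "x \<noteq> 0" "i < d"
  shows "W_weight q d x (Suc i) =
           - (inverse x * q powi (int d - 2 * int i - 1)) * W_weight q d x i"
    and "W_weight q d x i =
           - (x * q powi (2 * int i + 1 - int d)) * W_weight q d x (Suc i)"
proof -
  obtain e where d: "d = i + Suc e" using assms(3) less_iff_Suc_add by auto
  have "q ^ (Suc i * e) = q powi (int d - 2 * int i - 1) * q ^ (i * Suc e)"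
  proof -
    have "q powi (int d - 2 * int i - 1) * q powi (int (i * Suc e)) = q powi (int (Suc i * e))"
      using assms(1) by (subst power_int_add[symmetric]) (simp_all add: d algebra_simps)
    then show ?thesis by (simp only: power_int_of_nat)
  qed
  moreover have "x powi (- int (Suc i)) = inverse x * x powi (- int i)"
    unfolding power_int_minus power_int_of_nat by simp
  ultimately show *: "W_weight q d x (Suc i) =
           - (inverse x * q powi (int d - 2 * int i - 1)) * W_weight q d x i"
    by (simp add: W_weight_def d)
  have "q powi (2 * int i + 1 - int d) * q powi (int d - 2 * int i - 1) = 1"
    using assms(1) by (subst power_int_add[symmetric]) simp_all
  then have "x * q powi (2 * int i + 1 - int d) *
             (inverse x * q powi (int d - 2 * int i - 1)) = 1"
    using assms(2) by (simp add: field_simps)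
  then show "W_weight q d x i =
           - (x * q powi (2 * int i + 1 - int d)) * W_weight q d x (Suc i)"
    unfolding * by (metis minus_mult_minus mult.assoc mult_1)
qed

section \<open>Diagonality of the conjugate minus the third map\<close>

text \<open>
  One of the three claims, for any three maps in the roles of \<open>A\<close>, \<open>B\<close>, \<open>C\<close>. Each off-diagonal
  entry of the relation involves only the corresponding entries of \<open>Y\<close> and \<open>Z\<close>, because \<open>X\<close> is
  diagonal.
\<close>

lemma bar_map_in_generated:
  assumes "vector_space scale" and q: "q \<noteq> 0" "q ^ 4 \<noteq> 1" and x: "x \<noteq> 0"
    and X: "X \<in> End_alg scale" and Y: "Y \<in> End_alg scale" and Z: "Z \<in> End_alg scale"
    and std: "standard_ordering scale d X Y Z (huang_eigenvalue q d x)"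
    and rel: "huang_relation scale q Z X Y r"
  shows "bar_map scale q d x X Y Z \<in> generated_subalgebra scale X"
proof -
  let ?th = "huang_eigenvalue q d x"
  let ?t = "W_weight q d x"
  obtain v where lb: "leonard_basis scale d X Y Z v"
    and ev: "\<forall>i\<le>d. v i \<in> eigenspace scale X (?th i)"
    using std by (auto simp: standard_ordering_def)
  have lin: "Vector_Spaces.linear scale scale X" "Vector_Spaces.linear scale scale Y"
    "Vector_Spaces.linear scale scale Z"
    using X Y Z by (simp_all add: End_alg_def)
  interpret simple_eigenbasis scale d v X ?th
    by (intro simple_eigenbasis.intro simple_eigenbasis_axioms.intro)
      (use assms(1) lb ev std lin in
        \<open>auto simp: leonard_basis_def eigenspace_def standard_ordering_def bij_betw_def\<close>)
  have W: "W_map scale q d x X = diag_op ?t"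
    by (auto simp: W_map_def diag_op_def primitive_idempotent_eq W_weight_def)
  define K where "K = q powi 2 - q powi (- 2)"
  have K: "K \<noteq> 0"
  proof
    assume "K = 0"
    then have "q ^ 2 * q ^ 2 = 1" using q(1) by (simp add: K_def power_int_minus field_simps)
    then show False using q(2) by (simp flip: power_add)
  qed
  note steps = huang_eigenvalue_steps[OF q(1) x, folded K_def]
  have entry: "coord i (Z (v j)) = - inverse K * (q * ?th i - inverse q * ?th j) * coord i (Y (v j))"
    if "i \<le> d" "j \<le> d" "i \<noteq> j" for i j
  proof -
    interpret Y: Vector_Spaces.linear scale scale Y by (fact lin)
    have "coord i (Z (v j) + scale (inverse K)
            (scale q (X (Y (v j))) - scale (inverse q) (Y (X (v j))))) = coord i (scale r (v j))"
      using rel by (simp add: huang_relation_def K_def)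
    moreover have "Y (X (v j)) = scale (?th j) (Y (v j))" using that by (simp add: eigen Y.scale)
    moreover have "coord i (X y) = ?th i * coord i y" for y
      using that by (simp add: X_eq_diag_op coord_diag_op)
    ultimately have "coord i (Z (v j)) + inverse K *
        (q * (?th i * coord i (Y (v j))) - inverse q * (?th j * coord i (Y (v j)))) = 0"
      using that by (simp add: coord_add coord_diff coord_scale coord_basis mult.assoc)
    then show ?thesis by (simp add: eq_neg_iff_add_eq_0 algebra_simps)
  qed
  have "?t i * coord i (Z (v j)) = ?t j * coord i (Y (v j))"
    if ij: "i \<le> d" "j \<le> d" "i \<noteq> j" for i j
  proof -
    consider "j = Suc i" | "i = Suc j" | "coord i (Y (v j)) = 0"
      using lb ij unfolding leonard_basis_def irreducible_tridiagonal_def tridiagonal_def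
        matrix_wrt_def coord_def by blast
    then show ?thesis
    proof cases
      case 1
      then have "coord i (Z (v j)) =
          - (inverse x * q powi (int d - 2 * int i - 1)) * coord i (Y (v j))"
        using entry[OF ij] steps(1)[of d i] K by simp
      then show ?thesis using W_weight_Suc(1)[OF q(1) x, of i d] 1 ij by simp
    next
      case 2
      then have "coord i (Z (v j)) =
          - (x * q powi (2 * int j + 1 - int d)) * coord i (Y (v j))"
        using entry[OF ij] steps(2)[of d j] K by simp
      then show ?thesis using W_weight_Suc(2)[OF q(1) x, of j d] 2 ij by simp
    next
      case 3
      then show ?thesis using entry[OF ij] by simp
    qed
  qed
  moreover have "?t i \<noteq> 0" for i using q(1) x by (simp add: W_weight_def)
  ultimately have "bar_map scale q d x X Y Z =
      diag_op (\<lambda>i. coord i (Y (v i)) - coord i (Z (v i)))"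
    unfolding bar_map_def W by (intro conjugate_minus_eq_diag_op lin) auto
  then show ?thesis by (simp add: diag_op_in_generated)
qed

theorem lemma8p5:
  fixes scale :: "'f::field \<Rightarrow> 'v::ab_group_add \<Rightarrow> 'v"
    and d :: nat
    and q a b c :: 'f
    and A B C :: "'v \<Rightarrow> 'v"
  assumes "vector_space scale"
    and "vector_space.dim scale (UNIV :: 'v set) = d + 1"
    and "q \<noteq> 0" and "q ^ 4 \<noteq> 1"
    and "a \<noteq> 0" and "b \<noteq> 0" and "c \<noteq> 0"
    and "\<forall>i\<in>{1..d}. q ^ (2 * i) \<noteq> 1"
    and "\<forall>x\<in>{a, b, c}. \<forall>j\<in>{1 - int d..int d - 1}. x ^ 2 \<noteq> q powi (2 * j)"
    and "\<forall>x\<in>{a * b * c, inverse a * b * c, a * inverse b * c, a * b * inverse c}.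
           \<forall>k<d. x \<noteq> q powi (int d - 1 - 2 * int k)"
    and "q_racah_triple scale q a b c d A B C"
  shows "bar_map scale q d a A B C \<in> generated_subalgebra scale A
       \<and> bar_map scale q d b B C A \<in> generated_subalgebra scale B
       \<and> bar_map scale q d c C A B \<in> generated_subalgebra scale C"
  using assms by (auto simp: q_racah_triple_def leonard_triple_def intro!: bar_map_in_generated)

end
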